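(* Let $k$ and $t$ be integers with $k=\binom{t}{2}\ge 6$, and let $H$ be a graph with $|E(H)|\ge 3$ that is a subgraph of the balanced complete $(k-2)$-partite graph $K_{(k-2)\times 2}$. Then $$\operatorname{GM}_{k-1}(K_{1,3}:H)=\begin{cases}3, & t=4;\\ 18, & t=5;\\ (t-1)\binom{t-1}{3}+\binom{t-3}{3}+2\binom{t-3}{2}, & t\ge 6.\end{cases}$$
   Context: All graphs are finite, simple and without isolated vertices. A $k$-edge-coloring of a graph is a map from its edge set onto $\{1,\dots,k\}$ that is exact, i.e. every one of the $k$ colors is used at least once. An edge-colored graph is rainbow if all its edges have distinct colors and monochromatic if all its edges have the same color. A copy of a graph $F$ in a graph $G$ is a subgraph of $G$ isomorphic to $F$; distinct copies are distinct subgraphs. $K_{(m)\times 2}$ denotes the complete $m$-partite graph with every part of size $2$. For non-empty graphs $G,H$ and a positive integer $k$, the Gallai-Ramsey number $\operatorname{gr}_k(G:H)$ is the minimum integer $N$ such that for all $n\ge N$, every (exact) $k$-edge-coloring of $K_n$ contains a rainbow copy of $G$ or a monochromatic copy of $H$. The Gallai-Ramsey multiplicity $\operatorname{GM}_k(G:H)$ is the minimum, over all (exact) $k$-edge-colorings of $K_{\operatorname{gr}_k(G:H)}$, of the total number of rainbow copies of $G$ plus monochromatic copies of $H$.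
   Formalization: The Gallai-Ramsey number is taken as the minimum only over those N for which K_N has an exact edge-coloring with the given number of colors; read literally, small N satisfy the definition vacuously and the multiplicity would be a minimum over an empty set. *)

theory Defs
  imports Main
begin

record 'a ugraph =
  verts :: "'a set"
  edges :: "'a set set"

definition finite_simple_graph :: "'a ugraph \<Rightarrow> bool" where
  "finite_simple_graph G \<longleftrightarrow> finite (verts G) \<and> (\<forall>e\<in>edges G. e \<subseteq> verts G \<and> card e = 2)"

definition no_isolated_verts :: "'a ugraph \<Rightarrow> bool" where
  "no_isolated_verts G \<longleftrightarrow> (\<forall>v\<in>verts G. \<exists>e\<in>edges G. v \<in> e)"

definition subgraph :: "'a ugraph \<Rightarrow> 'a ugraph \<Rightarrow> bool" where
  "subgraph F G \<longleftrightarrow> finite_simple_graph F \<and> verts F \<subseteq> verts G \<and> edges F \<subseteq> edges G"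

definition isomorphic :: "'a ugraph \<Rightarrow> 'b ugraph \<Rightarrow> bool" where
  "isomorphic F G \<longleftrightarrow>
    (\<exists>f. bij_betw f (verts F) (verts G) \<and> edges G = (\<lambda>e. f ` e) ` edges F)"

definition copies :: "'a ugraph \<Rightarrow> 'b ugraph \<Rightarrow> 'b ugraph set" where
  "copies F G = {F'. subgraph F' G \<and> isomorphic F F'}"

definition complete_graph :: "nat \<Rightarrow> nat ugraph" where
  "complete_graph n = \<lparr>verts = {..<n}, edges = {e. e \<subseteq> {..<n} \<and> card e = 2}\<rparr>"

text \<open>The complete multipartite graph whose parts have the listed sizes;
  the vertex \<open>(i, j)\<close> is the \<open>j\<close>-th vertex of the \<open>i\<close>-th part.\<close>

definition complete_multipartite :: "nat list \<Rightarrow> (nat \<times> nat) ugraph" where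
  "complete_multipartite ps =
    (let V = {(i, j). i < length ps \<and> j < ps ! i}
     in \<lparr>verts = V, edges = {{u, v} | u v. u \<in> V \<and> v \<in> V \<and> fst u \<noteq> fst v}\<rparr>)"

abbreviation K_1_3 :: "(nat \<times> nat) ugraph" where
  "K_1_3 \<equiv> complete_multipartite [1, 3]"

abbreviation K_parts_of_two :: "nat \<Rightarrow> (nat \<times> nat) ugraph" where
  "K_parts_of_two m \<equiv> complete_multipartite (replicate m 2)"

text \<open>Colorings are total functions on vertex sets; only their values on edges matter.\<close>

definition exact_coloring :: "nat \<Rightarrow> 'a ugraph \<Rightarrow> ('a set \<Rightarrow> nat) \<Rightarrow> bool" where
  "exact_coloring k G c \<longleftrightarrow> c ` edges G = {1..k}"

definition rainbow :: "('a set \<Rightarrow> nat) \<Rightarrow> 'a ugraph \<Rightarrow> bool" where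
  "rainbow c F \<longleftrightarrow> inj_on c (edges F)"

definition monochromatic :: "('a set \<Rightarrow> nat) \<Rightarrow> 'a ugraph \<Rightarrow> bool" where
  "monochromatic c F \<longleftrightarrow> (\<exists>i. \<forall>e\<in>edges F. c e = i)"

definition rainbow_copies ::
    "('c set \<Rightarrow> nat) \<Rightarrow> 'a ugraph \<Rightarrow> 'c ugraph \<Rightarrow> 'c ugraph set" where
  "rainbow_copies c G K = {F \<in> copies G K. rainbow c F}"

definition monochromatic_copies ::
    "('c set \<Rightarrow> nat) \<Rightarrow> 'a ugraph \<Rightarrow> 'c ugraph \<Rightarrow> 'c ugraph set" where
  "monochromatic_copies c H K = {F \<in> copies H K. monochromatic c F}"

text \<open>The first conjunct makes explicit that \<open>N\<close> ranges over orders for which exact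
  \<open>k\<close>-edge-colorings of \<open>K\<^sub>N\<close> exist. Without it, all \<open>n\<close> with fewer than \<open>k\<close> edges in
  \<open>K\<^sub>n\<close> would satisfy the second conjunct vacuously, and the multiplicity below could
  be a minimum over an empty set of colorings.\<close>

definition gallai_ramsey :: "nat \<Rightarrow> 'a ugraph \<Rightarrow> 'b ugraph \<Rightarrow> nat" where
  "gallai_ramsey k G H =
    (LEAST N. (\<exists>c. exact_coloring k (complete_graph N) c) \<and>
      (\<forall>n\<ge>N. \<forall>c. exact_coloring k (complete_graph n) c \<longrightarrow>
        rainbow_copies c G (complete_graph n) \<noteq> {} \<or>
        monochromatic_copies c H (complete_graph n) \<noteq> {}))"

definition gallai_ramsey_multiplicity :: "nat \<Rightarrow> 'a ugraph \<Rightarrow> 'b ugraph \<Rightarrow> nat" where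
  "gallai_ramsey_multiplicity k G H =
    (let K = complete_graph (gallai_ramsey k G H) in
     LEAST m. \<exists>c. exact_coloring k K c \<and>
       m = card (rainbow_copies c G K) + card (monochromatic_copies c H K))"

end

theory Submission
  imports Defs
begin

text \<open>In an edge-coloring of a complete graph without rainbow \<open>K\<^sub>1\<^sub>,\<^sub>3\<close> every vertex sees at most
  two colors, and the color sets of two vertices intersect. If there are at least four colors, such
  an intersecting family has a common element \<open>a\<close>. Choosing an edge of every other color gives
  disjoint pairs with all edges between different pairs colored \<open>a\<close>, which is a monochromatic
  complete multipartite graph with parts of size two. Hence the Gallai-Ramsey number for \<open>k - 1\<close>
  colors is the least order with enough edges, namely \<open>t\<close>. An exact coloring of \<open>K\<^sub>t\<close> with one color
  fewer than edges repeats exactly one color, on two edges. No three edges are monochromatic, and of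
  the \<open>t * ((t - 1) choose 3)\<close> claws only those that contain both edges of the repeated color fail to
  be rainbow; there are \<open>t - 3\<close> of them if the two edges are adjacent and none otherwise.\<close>

section \<open>Stars\<close>

definition star :: "'a \<Rightarrow> 'a set \<Rightarrow> 'a ugraph" where
  "star v S = \<lparr>verts = insert v S, edges = (\<lambda>x. {v, x}) ` S\<rparr>"

lemma inj_on_insert_pair: "inj_on (\<lambda>x. {v, x}) S"
  by (auto simp: inj_on_def doubleton_eq_iff)

lemma K_1_3_eq_star: "K_1_3 = star (0, 0) ({1} \<times> {..<3})"
proof -
  have less_2: "i < Suc (Suc 0) \<longleftrightarrow> i = 0 \<or> i = 1" for i :: nat
    by auto
  have V: "{(i, j). i < length [1, 3::nat] \<and> j < [1, 3] ! i} =
      insert (0, 0) ({1} \<times> {..<3::nat})"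
    by (auto simp: less_2)
  have "{{u, v} | u v. u \<in> insert (0, 0) ({1} \<times> {..<3}) \<and>
      v \<in> insert (0, 0) ({1} \<times> {..<3}) \<and> fst u \<noteq> fst v}
    = (\<lambda>x. {(0, 0), x}) ` ({1::nat} \<times> {..<3::nat})" (is "?L = ?R")
  proof
    show "?L \<subseteq> ?R"
      by (auto simp: image_iff insert_commute)
    show "?R \<subseteq> ?L"
    proof
      fix e assume "e \<in> ?R"
      then obtain j where "e = {(0, 0), (1, j)}" "j < 3"
        by auto
      then show "e \<in> ?L"
        unfolding mem_Collect_eq by (metis SigmaI fst_conv insertCI lessThan_iff zero_neq_one)
    qed
  qed
  then show ?thesis
    unfolding complete_multipartite_def Let_def V star_def by simp
qed

text \<open>An isomorphism carries center to center and leaves to leaves; conversely any bijection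
  of the leaf sets extends by the centers. So a copy of a star is given by a center and a leaf set
  of the right size, which reduces counting copies to counting pairs.\<close>

lemma isomorphic_star_iff:
  assumes "v \<notin> S" "finite S"
  shows "isomorphic (star v S) G \<longleftrightarrow>
    (\<exists>w T. G = star w T \<and> w \<notin> T \<and> finite T \<and> card T = card S)"
proof
  assume "isomorphic (star v S) G"
  then obtain f where f: "bij_betw f (insert v S) (verts G)"
    and e: "edges G = (\<lambda>e. f ` e) ` (\<lambda>x. {v, x}) ` S"
    by (auto simp: isomorphic_def star_def)
  have inj: "inj_on f (insert v S)"
    using f by (simp add: bij_betw_def)
  have "G = star (f v) (f ` S)"
    using f e by (simp add: star_def bij_betw_def image_image)
  moreover have "f v \<notin> f ` S"
    using inj assms by (auto simp: inj_on_def)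
  moreover have "card (f ` S) = card S"
    using inj by (intro card_image) (auto simp: inj_on_def)
  ultimately show "\<exists>w T. G = star w T \<and> w \<notin> T \<and> finite T \<and> card T = card S"
    using assms(2) by blast
next
  assume "\<exists>w T. G = star w T \<and> w \<notin> T \<and> finite T \<and> card T = card S"
  then obtain w T where G: "G = star w T" and w: "w \<notin> T" and T: "finite T" "card T = card S"
    by blast
  then obtain g where g: "bij_betw g S T"
    using assms(2) finite_same_card_bij by metis
  define f where "f = g(v := w)"
  have fS: "f x = g x" if "x \<in> S" for x
    using that assms(1) by (auto simp: f_def)
  have "bij_betw f S T"
    using g fS bij_betw_cong by blast
  then have "bij_betw f (insert v S) (insert w T)"
    using w assms(1) notIn_Un_bij_betw[of v S f T] by (simp add: f_def)
  moreover have "(\<lambda>x. {w, x}) ` T = (\<lambda>e. f ` e) ` (\<lambda>x. {v, x}) ` S"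
  proof -
    have "T = f ` S"
      using \<open>bij_betw f S T\<close> by (simp add: bij_betw_def)
    moreover have "f v = w"
      by (simp add: f_def)
    ultimately show ?thesis
      by (simp add: image_image)
  qed
  ultimately show "isomorphic (star v S) G"
    by (auto simp: isomorphic_def star_def G)
qed

lemma subgraph_star_complete_graph:
  assumes "w \<notin> T" "finite T"
  shows "subgraph (star w T) (complete_graph n) \<longleftrightarrow> w < n \<and> T \<subseteq> {..<n}"
proof -
  have "card {w, x} = 2" if "x \<in> T" for x
    using that assms(1) by (subst card_2_iff) blast
  then show ?thesis
    using assms(2) by (auto simp: subgraph_def finite_simple_graph_def star_def complete_graph_def)
qed

text \<open>If the centers differed, a leaf \<open>x\<close> of \<open>v\<close> other than
  \<open>w\<close> would give an edge that misses \<open>w\<close>. Two leaves guarantee such an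
  \<open>x\<close>; a single edge is a star around either of its ends.\<close>

lemma star_eq_imp:
  assumes "star v S = star w T" "v \<notin> S" "w \<notin> T" "card S \<ge> 2"
  shows "v = w \<and> S = T"
proof -
  have e: "(\<lambda>x. {v, x}) ` S = (\<lambda>x. {w, x}) ` T" and i: "insert v S = insert w T"
    using assms(1) by (auto simp: star_def)
  have "v = w"
  proof (rule ccontr)
    assume "v \<noteq> w"
    have "\<not> S \<subseteq> {w}"
      using assms(4) card_mono[of "{w}" S] by auto
    then obtain x where x: "x \<in> S" "x \<noteq> w"
      by blast
    then have "{v, x} \<in> (\<lambda>x. {w, x}) ` T"
      using e by blast
    then show False
      using \<open>v \<noteq> w\<close> x by auto
  qed
  then show ?thesis
    using i assms(2,3) by (metis insert_ident)
qed

section \<open>Counting claws and rainbow claws in complete graphs\<close>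

definition claws :: "nat \<Rightarrow> (nat \<times> nat set) set" where
  "claws n = (SIGMA v:{..<n}. {S. S \<subseteq> {..<n} - {v} \<and> card S = 3})"

lemma finite_claws: "finite (claws n)"
  unfolding claws_def by (intro finite_SigmaI) auto

lemma card_claws: "card (claws n) = n * ((n - 1) choose 3)"
proof -
  have "card {S. S \<subseteq> {..<n} - {v} \<and> card S = 3} = (n - 1) choose 3" if "v < n" for v
    using that n_subsets[of "{..<n} - {v}" 3] by simp
  then show ?thesis
    unfolding claws_def by (subst card_SigmaI) auto
qed

lemma copies_K_1_3_complete_graph:
  "copies K_1_3 (complete_graph n) = (\<lambda>(v, S). star v S) ` claws n"
proof -
  have iso: "isomorphic K_1_3 F \<longleftrightarrow> (\<exists>w T. F = star w T \<and> w \<notin> T \<and> finite T \<and> card T = 3)"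
    for F :: "nat ugraph"
    unfolding K_1_3_eq_star by (subst isomorphic_star_iff) auto
  show ?thesis
  proof (intro set_eqI iffI)
    fix F assume "F \<in> copies K_1_3 (complete_graph n)"
    then obtain w T where F: "F = star w T" "w \<notin> T" "finite T" "card T = 3"
      and "subgraph F (complete_graph n)"
      unfolding copies_def mem_Collect_eq iso by blast
    then have "(w, T) \<in> claws n"
      by (auto simp: subgraph_star_complete_graph claws_def)
    then show "F \<in> (\<lambda>(v, S). star v S) ` claws n"
      using F by force
  next
    fix F assume "F \<in> (\<lambda>(v, S). star v S) ` claws n"
    then obtain w T where F: "F = star w T" "w < n" "T \<subseteq> {..<n} - {w}" "card T = 3"
      by (auto simp: claws_def)
    then have "w \<notin> T" "finite T"
      by (auto intro: finite_subset)
    then show "F \<in> copies K_1_3 (complete_graph n)"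
      using F unfolding copies_def mem_Collect_eq iso by (auto simp: subgraph_star_complete_graph)
  qed
qed

text \<open>The complement of the rainbow claws is the set to estimate: when only one color repeats,
  it has at most \<open>n - 3\<close> elements.\<close>

definition nonrainbow_claws :: "nat \<Rightarrow> (nat set \<Rightarrow> nat) \<Rightarrow> (nat \<times> nat set) set" where
  "nonrainbow_claws n c = {(v, S) \<in> claws n. \<not> inj_on (\<lambda>x. c {v, x}) S}"

lemma rainbow_star_iff: "rainbow c (star v S) \<longleftrightarrow> inj_on (\<lambda>x. c {v, x}) S"
  using comp_inj_on_iff[OF inj_on_insert_pair[of v S], of c]
  by (simp add: rainbow_def star_def comp_def)

lemma rainbow_copies_K_1_3:
  "rainbow_copies c K_1_3 (complete_graph n) =
    (\<lambda>(v, S). star v S) ` (claws n - nonrainbow_claws n c)"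
  unfolding rainbow_copies_def copies_K_1_3_complete_graph
  by (auto simp: nonrainbow_claws_def rainbow_star_iff)

lemma card_rainbow_copies_K_1_3:
  "card (rainbow_copies c K_1_3 (complete_graph n)) =
    n * ((n - 1) choose 3) - card (nonrainbow_claws n c)"
proof -
  have "inj_on (\<lambda>(v, S). star v S) (claws n)"
  proof (rule inj_onI, clarify)
    fix v S w T
    assume "(v, S) \<in> claws n" "(w, T) \<in> claws n" "star v S = star w T"
    then show "v = w \<and> S = T"
      by (intro star_eq_imp) (auto simp: claws_def)
  qed
  then have "card (rainbow_copies c K_1_3 (complete_graph n)) = card (claws n - nonrainbow_claws n c)"
    unfolding rainbow_copies_K_1_3 by (intro card_image) (auto intro: inj_on_subset)
  moreover have "nonrainbow_claws n c \<subseteq> claws n"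
    by (auto simp: nonrainbow_claws_def)
  ultimately show ?thesis
    by (simp add: card_Diff_subset finite_subset[OF _ finite_claws] card_claws)
qed

section \<open>Colorings without rainbow claws\<close>

lemma edges_complete_graph: "edges (complete_graph n) = {e. e \<subseteq> {..<n} \<and> card e = 2}"
  by (simp add: complete_graph_def)

lemma finite_edges_complete_graph: "finite (edges (complete_graph n))"
  by (simp add: edges_complete_graph)

lemma card_edges_complete_graph: "card (edges (complete_graph n)) = n choose 2"
  using n_subsets[of "{..<n}" 2] by (simp add: edges_complete_graph)

lemma pair_in_edges_complete_graph:
  "{u, v} \<in> edges (complete_graph n) \<longleftrightarrow> u < n \<and> v < n \<and> u \<noteq> v"
  by (auto simp: edges_complete_graph card_2_iff doubleton_eq_iff)

lemma edges_complete_graphE: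
  assumes "e \<in> edges (complete_graph n)"
  obtains u v where "e = {u, v}" "u < n" "v < n" "u \<noteq> v"
  using assms by (auto simp: edges_complete_graph card_2_iff)

text \<open>Pairwise intersecting sets of size at most two either share an element or contain a
  triangle {a, b}, {b, d}, {a, d}. A triangle confines every further set to {a, b, d}, so the union
  has at most three elements.\<close>

lemma intersecting_small_sets_common_element:
  fixes C :: "'v \<Rightarrow> 'c set"
  assumes fin: "\<And>v. v \<in> V \<Longrightarrow> finite (C v)"
    and small: "\<And>v. v \<in> V \<Longrightarrow> card (C v) \<le> 2"
    and int: "\<And>u v. u \<in> V \<Longrightarrow> v \<in> V \<Longrightarrow> C u \<inter> C v \<noteq> {}"
    and big: "card (\<Union>v\<in>V. C v) \<ge> 4"
  shows "\<exists>a. \<forall>v\<in>V. a \<in> C v"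
proof (rule ccontr)
  assume no: "\<nexists>a. \<forall>v\<in>V. a \<in> C v"
  have no3: False if "v \<in> V" "x \<in> C v" "y \<in> C v" "z \<in> C v" "x \<noteq> y" "x \<noteq> z" "y \<noteq> z" for v x y z
  proof -
    have "card {x, y, z} \<le> card (C v)"
      using that fin by (intro card_mono) auto
    then show False
      using that small[of v] by simp
  qed
  have "V \<noteq> {}"
    using big by auto
  \<comment> \<open>\<open>int\<close> with equal indices makes every \<open>C v\<close>
    non-empty.\<close>
  then obtain v a where v: "v \<in> V" "a \<in> C v"
    using int by blast
  obtain w where w: "w \<in> V" "a \<notin> C w"
    using no by blast
  obtain b where b: "b \<in> C v" "b \<in> C w"
    using int v w by blast
  obtain x where x: "x \<in> V" "b \<notin> C x"
    using no by blast
  obtain d where d: "d \<in> C w" "d \<in> C x"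
    using int w x by blast
  have dist: "a \<noteq> b" "a \<noteq> d" "b \<noteq> d"
    using w b x d by auto
  have Cv: "C v \<subseteq> {a, b}" and Cw: "C w \<subseteq> {b, d}"
    using no3 v w b d dist by blast+
  have a: "a \<in> C x"
    using int[of v x] v x Cv by blast
  then have Cx: "C x \<subseteq> {a, d}"
    using no3 x d dist by blast
  have "C y \<subseteq> {a, b, d}" if y: "y \<in> V" for y
  proof
    fix z assume z: "z \<in> C y"
    show "z \<in> {a, b, d}"
    proof (rule ccontr)
      assume "z \<notin> {a, b, d}"
      \<comment> \<open>With \<open>z\<close> outside the triangle, \<open>C y\<close> has room for
        only one of \<open>a\<close>, \<open>b\<close>, \<open>d\<close>, but one element cannot
        meet all three sides.\<close>
      moreover have "C y \<inter> {a, b} \<noteq> {}" "C y \<inter> {b, d} \<noteq> {}" "C y \<inter> {a, d} \<noteq> {}"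
        using int[OF y v(1)] int[OF y w(1)] int[OF y x(1)] Cv Cw Cx by blast+
      ultimately show False
        using no3[OF y z] dist by blast
    qed
  qed
  then have "card (\<Union>v\<in>V. C v) \<le> card {a, b, d}"
    by (intro card_mono) auto
  also have "\<dots> \<le> 3"
    by (simp add: card_insert_if)
  finally show False
    using big by simp
qed

lemma isomorphic_image:
  assumes "isomorphic H F" "inj_on f (verts F)"
  shows "isomorphic H \<lparr>verts = f ` verts F, edges = (\<lambda>e. f ` e) ` edges F\<rparr>"
proof -
  obtain g where g: "bij_betw g (verts H) (verts F)" "edges F = (\<lambda>e. g ` e) ` edges H"
    using assms(1) by (auto simp: isomorphic_def)
  have "bij_betw (f \<circ> g) (verts H) (f ` verts F)"
    using g(1) assms(2) by (rule bij_betw_trans[OF _ inj_on_imp_bij_betw])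
  moreover have "(\<lambda>e. f ` e) ` edges F = (\<lambda>e. (f \<circ> g) ` e) ` edges H"
    using g(2) by (simp add: image_image image_comp)
  ultimately show ?thesis
    unfolding isomorphic_def by auto
qed

lemma verts_K_parts_of_two: "verts (K_parts_of_two m) = {..<m} \<times> {..<2}"
  by (auto simp: complete_multipartite_def Let_def)

lemma edges_K_parts_of_twoE:
  assumes "e \<in> edges (K_parts_of_two m)"
  obtains i j i' j' where "e = {(i, j), (i', j')}" "i < m" "i' < m" "j < 2" "j' < 2" "i \<noteq> i'"
  using assms by (auto simp: complete_multipartite_def Let_def)

lemma card_colors_le_2:
  assumes "rainbow_copies c K_1_3 (complete_graph n) = {}" "v < n"
  shows "card ((\<lambda>x. c {v, x}) ` ({..<n} - {v})) \<le> 2"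
proof (rule ccontr)
  let ?C = "(\<lambda>x. c {v, x}) ` ({..<n} - {v})"
  assume "\<not> card ?C \<le> 2"
  then obtain D where D: "D \<subseteq> ?C" "card D = 3"
    using obtain_subset_with_card_n[of 3 ?C] by (metis not_less_eq_eq numeral_2_eq_2 numeral_3_eq_3)
  \<comment> \<open>One neighbor for each of three colors at \<open>v\<close> gives the leaves of a
    rainbow claw.\<close>
  then obtain S where S: "S \<subseteq> {..<n} - {v}" "inj_on (\<lambda>x. c {v, x}) S" "D = (\<lambda>x. c {v, x}) ` S"
    using D(1) unfolding subset_image_inj by blast
  then have "card S = 3"
    using D card_image by metis
  then have "(v, S) \<in> claws n - nonrainbow_claws n c"
    using S assms(2) by (auto simp: claws_def nonrainbow_claws_def)
  then show False
    using assms(1) unfolding rainbow_copies_K_1_3 by blast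
qed

text \<open>The color sets \<open>C v\<close> intersect pairwise because the color of an edge lies
  in the sets of both ends. With four colors they share some \<open>a\<close>, and since
  \<open>C u\<close> has size at most two, \<open>u\<close> sees at most one color besides
  \<open>a\<close>.\<close>

lemma common_color:
  assumes "exact_coloring q (complete_graph n) c" "q \<ge> 4"
    and "rainbow_copies c K_1_3 (complete_graph n) = {}"
  obtains a where "a \<in> {1..q}"
    and "\<And>u v w. \<lbrakk>u < n; v < n; w < n; v \<noteq> u; w \<noteq> u\<rbrakk> \<Longrightarrow>
      c {u, v} = a \<or> c {u, w} = a \<or> c {u, v} = c {u, w}"
proof -
  define C where "C v = (\<lambda>x. c {v, x}) ` ({..<n} - {v})" for v
  have ex: "c ` edges (complete_graph n) = {1..q}"
    using assms(1) by (simp add: exact_coloring_def)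
  have U: "(\<Union>v\<in>{..<n}. C v) = {1..q}"
  proof
    show "(\<Union>v\<in>{..<n}. C v) \<subseteq> {1..q}"
      unfolding ex[symmetric] C_def
      by (auto intro!: imageI simp: pair_in_edges_complete_graph)
    show "{1..q} \<subseteq> (\<Union>v\<in>{..<n}. C v)"
      unfolding ex[symmetric] C_def by (auto elim!: edges_complete_graphE)
  qed
  have ne: "\<exists>w<n. w \<noteq> v" for v
  proof -
    have "1 \<in> c ` edges (complete_graph n)"
      using ex assms(2) by auto
    then obtain u w where "u < n" "w < n" "u \<noteq> w"
      by (auto elim!: edges_complete_graphE)
    then show ?thesis
      by metis
  qed
  have "\<exists>a. \<forall>v\<in>{..<n}. a \<in> C v"
  proof (rule intersecting_small_sets_common_element)
    show "finite (C v)" for v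
      by (simp add: C_def)
    show "card (C v) \<le> 2" if "v \<in> {..<n}" for v
      using card_colors_le_2[OF assms(3)] that by (simp add: C_def)
    show "4 \<le> card (\<Union>v\<in>{..<n}. C v)"
      using assms(2) U by simp
    show "C u \<inter> C v \<noteq> {}" if "u \<in> {..<n}" "v \<in> {..<n}" for u v
    proof (cases "u = v")
      case True
      then show ?thesis
        using ne[of v] by (auto simp: C_def)
    next
      case False
      then have "c {u, v} \<in> C u" "c {v, u} \<in> C v"
        using that by (auto simp: C_def)
      then show ?thesis
        by (auto simp: insert_commute)
    qed
  qed
  then obtain a where a: "\<And>v. v < n \<Longrightarrow> a \<in> C v"
    by auto
  show ?thesis
  proof
    show "a \<in> {1..q}"
      \<comment> \<open>\<open>ne[of 0]\<close> supplies a vertex, whose color set contains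
        \<open>a\<close>.\<close>
      using U a ne[of 0] by blast
    show "c {u, v} = a \<or> c {u, w} = a \<or> c {u, v} = c {u, w}"
      if "u < n" "v < n" "w < n" "v \<noteq> u" "w \<noteq> u" for u v w
    proof (rule ccontr)
      \<comment> \<open>Then \<open>a\<close> and the two edge colors are three different colors at
        \<open>u\<close>.\<close>
      assume "\<not> ?thesis"
      moreover have "{a, c {u, v}, c {u, w}} \<subseteq> C u"
        using that a by (auto simp: C_def)
      then have "card {a, c {u, v}, c {u, w}} \<le> card (C u)"
        by (intro card_mono) (auto simp: C_def)
      ultimately show False
        using card_colors_le_2[OF assms(3) that(1)] by (auto simp: C_def)
    qed
  qed
qed

text \<open>The map \<open>f\<close> sends part \<open>i\<close> of
  \<open>K_parts_of_two (q - 1)\<close> to the ends of an edge of color \<open>g i\<close>, where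
  \<open>g\<close> lists the colors other than \<open>a\<close>. These edges lie inside the parts,
  so only edges of color \<open>a\<close> are needed between them.\<close>

lemma monochromatic_copy_if_no_rainbow_claw:
  assumes ex: "exact_coloring q (complete_graph n) c" and q: "q \<ge> 4"
    and nr: "rainbow_copies c K_1_3 (complete_graph n) = {}"
    and H: "copies H (K_parts_of_two (q - 1)) \<noteq> {}"
  shows "monochromatic_copies c H (complete_graph n) \<noteq> {}"
proof -
  obtain a where a: "a \<in> {1..q}" and
    loc: "\<And>u v w. \<lbrakk>u < n; v < n; w < n; v \<noteq> u; w \<noteq> u\<rbrakk> \<Longrightarrow>
      c {u, v} = a \<or> c {u, w} = a \<or> c {u, v} = c {u, w}"
    using common_color[OF ex q nr] by blast
  have "card {..<q - 1} = card ({1..q} - {a})"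
    using a by simp
  then obtain g where g: "bij_betw g {..<q - 1} ({1..q} - {a})"
    using finite_same_card_bij[of "{..<q - 1}" "{1..q} - {a}"] by auto
  have "\<exists>u v. u < n \<and> v < n \<and> u \<noteq> v \<and> c {u, v} = g i" if "i < q - 1" for i
  proof -
    have "g i \<in> c ` edges (complete_graph n)"
      using bij_betwE[OF g] that ex by (simp add: exact_coloring_def)
    then obtain e where "e \<in> edges (complete_graph n)" "c e = g i"
      by auto
    then show ?thesis
      by (metis edges_complete_graphE)
  qed
  then obtain p p' where p: "\<And>i. i < q - 1 \<Longrightarrow>
      p i < n \<and> p' i < n \<and> p i \<noteq> p' i \<and> c {p i, p' i} = g i"
    by metis
  \<comment> \<open>Every nonzero \<open>j\<close> goes to \<open>p' i\<close>, so a bound on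
    \<open>j\<close> matters only for injectivity.\<close>
  define f where "f = (\<lambda>(i, j::nat). if j = 0 then p i else p' i)"
  have ga: "g i \<noteq> a" if "i < q - 1" for i
    using g that by (auto simp: bij_betw_def)
  have gi: "g i \<noteq> g i'" if "i < q - 1" "i' < q - 1" "i \<noteq> i'" for i i'
    using g that by (auto simp: bij_betw_def inj_on_def)
  have fn: "f (i, j) < n" if "i < q - 1" for i j
    using p[OF that] by (simp add: f_def)
  have partner: "\<exists>y<n. y \<noteq> f (i, j) \<and> c {f (i, j), y} = g i" if "i < q - 1" for i j
    using p[OF that] by (auto simp: f_def insert_commute)
  have own: "c {f (i, j), x} \<in> {a, g i}" if x: "i < q - 1" "x < n" "x \<noteq> f (i, j)" for i j x
  proof -
    obtain y where "y < n" "y \<noteq> f (i, j)" "c {f (i, j), y} = g i"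
      using partner[OF x(1), of j] by blast
    then show ?thesis
      using loc[OF fn[OF x(1), of j] x(2) \<open>y < n\<close> x(3)] ga[OF x(1)] by auto
  qed
  have fd: "f (i, j) \<noteq> f (i', j')" if i: "i < q - 1" "i' < q - 1" "i \<noteq> i'" for i i' j j'
  proof
    \<comment> \<open>A vertex shared by two parts would see \<open>g i\<close>, while
      \<open>own\<close> for \<open>i'\<close> allows it only \<open>a\<close> and
      \<open>g i'\<close>.\<close>
    assume eq: "f (i, j) = f (i', j')"
    obtain y where "y < n" "y \<noteq> f (i, j)" "c {f (i, j), y} = g i"
      using partner[OF i(1), of j] by blast
    then show False
      using own[OF i(2), of y j'] eq ga[OF i(1)] gi[OF i] by auto
  qed
  \<comment> \<open>The color lies in both {a, g i} and {a, g i'}, which share only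
    \<open>a\<close>.\<close>
  have fa: "c {f (i, j), f (i', j')} = a" if i: "i < q - 1" "i' < q - 1" "i \<noteq> i'" for i i' j j'
    using own[OF i(1) fn[OF i(2)], of j' j] own[OF i(2) fn[OF i(1)], of j j'] fd[OF i, of j j']
      gi[OF i] by (auto simp: insert_commute)
  have inj: "inj_on f ({..<q - 1} \<times> {..<2})"
  proof (rule inj_onI, clarify)
    fix i i' j j' :: nat
    assume "f (i, j) = f (i', j')" "i < q - 1" "i' < q - 1" "j < 2" "j' < 2"
    moreover from this have "i = i'"
      using fd by blast
    ultimately show "i = i' \<and> j = j'"
      using p[of i] by (auto simp: f_def less_2_cases_iff split: if_splits)
  qed
  obtain F where F: "finite_simple_graph F" "verts F \<subseteq> {..<q - 1} \<times> {..<2}"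
      "edges F \<subseteq> edges (K_parts_of_two (q - 1))" "isomorphic H F"
    using H by (auto simp: copies_def subgraph_def verts_K_parts_of_two)
  define F' where "F' = \<lparr>verts = f ` verts F, edges = (\<lambda>e. f ` e) ` edges F\<rparr>"
  have edge: "f ` e \<in> edges (complete_graph n) \<and> c (f ` e) = a" if e: "e \<in> edges F" for e
  proof -
    have "e \<in> edges (K_parts_of_two (q - 1))"
      using e F(3) by (rule rev_subsetD)
    then obtain i j i' j' where "e = {(i, j), (i', j')}" "i < q - 1" "i' < q - 1" "i \<noteq> i'"
      by (rule edges_K_parts_of_twoE)
    then show ?thesis
      using fa fd fn by (simp add: pair_in_edges_complete_graph)
  qed
  have "isomorphic H F'"
    unfolding F'_def using F inj by (intro isomorphic_image) (auto intro: inj_on_subset)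
  moreover have "finite_simple_graph F'"
    using F(1) edge image_mono[of _ "verts F" f]
    by (simp add: F'_def finite_simple_graph_def edges_complete_graph)
  moreover have "verts F' \<subseteq> {..<n}"
    using F(2) fn by (auto simp: F'_def)
  moreover have "edges F' \<subseteq> edges (complete_graph n)"
    using edge by (auto simp: F'_def)
  moreover have "monochromatic c F'"
    using edge by (auto simp: F'_def monochromatic_def)
  ultimately have "F' \<in> monochromatic_copies c H (complete_graph n)"
    by (simp add: monochromatic_copies_def copies_def subgraph_def complete_graph_def)
  then show ?thesis
    by blast
qed

section \<open>Colorings with one repeated color\<close>

text \<open>Dropping either of two colliding elements \<open>x\<close>, \<open>y\<close> keeps the
  image, so \<open>m\<close> elements remain for \<open>m\<close> values and \<open>f\<close> is
  injective on them. Hence every colliding pair contains both \<open>x\<close> and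
  \<open>y\<close>.\<close>

lemma surj_one_short_repeat:
  assumes "finite E" "card E = Suc m" "card (f ` E) = m"
  obtains x y where "x \<in> E" "y \<in> E" "x \<noteq> y" "f x = f y"
    "\<And>u v. \<lbrakk>u \<in> E; v \<in> E; u \<noteq> v; f u = f v\<rbrakk> \<Longrightarrow> {u, v} = {x, y}"
proof -
  have "\<not> inj_on f E"
    using assms card_image[of f E] by auto
  then obtain x y where xy: "x \<in> E" "y \<in> E" "x \<noteq> y" "f x = f y"
    by (auto simp: inj_on_def)
  have inj: "inj_on f (E - {z})" if z: "z \<in> {x, y}" for z
  proof (rule eq_card_imp_inj_on)
    have "f ` (E - {z}) = f ` E"
    proof -
      define z' where "z' = (if z = x then y else x)"
      have "z' \<in> E - {z}" "f z' = f z"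
        using z xy by (auto simp: z'_def)
      then have "f z \<in> f ` (E - {z})"
        by (metis imageI)
      moreover have "E = insert z (E - {z})"
        using z xy by auto
      ultimately show ?thesis
        by (metis image_insert insert_absorb)
    qed
    then show "card (f ` (E - {z})) = card (E - {z})"
      using assms z xy by auto
  qed (use assms in simp)
  show ?thesis
  proof
    show "{u, v} = {x, y}" if uv: "u \<in> E" "v \<in> E" "u \<noteq> v" "f u = f v" for u v
    proof -
      have "z \<in> {u, v}" if "z \<in> {x, y}" for z
        using inj_onD[OF inj[OF that] uv(4)] uv(1-3) by blast
      then show ?thesis
        using xy(3) by blast
    qed
  qed (fact xy)+
qed

text \<open>A claw that is not rainbow contains both edges of the repeated color. These fix its
  center and two leaves, so only the third leaf is free.\<close>

lemma card_nonrainbow_claws_le: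
  assumes "exact_coloring q (complete_graph n) c" "n choose 2 = Suc q"
  shows "card (nonrainbow_claws n c) \<le> n - 3"
proof (cases "nonrainbow_claws n c = {}")
  case False
  have "card (c ` edges (complete_graph n)) = q"
    using assms(1) by (simp add: exact_coloring_def)
  then obtain e e' where
    uniq: "\<And>d d'. \<lbrakk>d \<in> edges (complete_graph n); d' \<in> edges (complete_graph n); d \<noteq> d'; c d = c d'\<rbrakk>
      \<Longrightarrow> {d, d'} = {e, e'}"
    using surj_one_short_repeat[OF finite_edges_complete_graph]
    by (metis card_edges_complete_graph assms(2))
  have repeat: "\<exists>x y. x \<in> S \<and> y \<in> S \<and> x \<noteq> y \<and> {{v, x}, {v, y}} = {e, e'}"
    if vS: "(v, S) \<in> nonrainbow_claws n c" for v S
  proof -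
    obtain x y where "x \<in> S" "y \<in> S" "x \<noteq> y" "c {v, x} = c {v, y}"
      using vS by (auto simp: nonrainbow_claws_def inj_on_def)
    moreover from this have "{v, x} \<in> edges (complete_graph n)" "{v, y} \<in> edges (complete_graph n)"
      using vS by (auto simp: nonrainbow_claws_def claws_def pair_in_edges_complete_graph)
    ultimately show ?thesis
      using uniq by (metis doubleton_eq_iff)
  qed
  obtain v S where vS: "(v, S) \<in> nonrainbow_claws n c"
    using False by auto
  then obtain x y where xy: "x \<in> S" "y \<in> S" "x \<noteq> y" "{{v, x}, {v, y}} = {e, e'}"
    using repeat by blast
  have vxy: "v < n" "x < n" "y < n" "x \<noteq> v" "y \<noteq> v"
    using vS xy by (auto simp: nonrainbow_claws_def claws_def)
  have "nonrainbow_claws n c \<subseteq> (\<lambda>z. (v, {x, y, z})) ` ({..<n} - {v, x, y})"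
  proof clarify
    fix w T assume wT: "(w, T) \<in> nonrainbow_claws n c"
    then obtain x' y' where *: "x' \<in> T" "y' \<in> T" "x' \<noteq> y'"
      and "{{w, x'}, {w, y'}} = {{v, x}, {v, y}}"
      using repeat xy(4) by metis
    \<comment> \<open>The two repeated edges meet in a single vertex, which must be the
      center.\<close>
    then have eq: "w = v" "{x', y'} = {x, y}"
      using xy(3) by (auto simp: doubleton_eq_iff)
    have T: "T \<subseteq> {..<n} - {v}" "card T = 3"
      using wT eq by (auto simp: nonrainbow_claws_def claws_def)
    have "{x, y} \<subseteq> T"
      using * eq by auto
    then have "card (T - {x, y}) = 1"
      using T xy(3) by (simp add: card_Diff_subset)
    then obtain z where "T - {x, y} = {z}"
      by (auto simp: card_1_singleton_iff)
    then have "T = {x, y, z}" "z \<in> {..<n} - {v, x, y}"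
      using \<open>{x, y} \<subseteq> T\<close> T(1) by auto
    then show "(w, T) \<in> (\<lambda>z. (v, {x, y, z})) ` ({..<n} - {v, x, y})"
      using eq by blast
  qed
  then have "card (nonrainbow_claws n c) \<le> card ({..<n} - {v, x, y})"
    by (intro surj_card_le) auto
  also have "\<dots> = n - 3"
    using vxy xy(3) by (subst card_Diff_subset) auto
  finally show ?thesis .
qed simp

text \<open>All edges except {0, 1} receive distinct colors, and {0, 1} reuses the color of {0, 2}.
  Making the repeated edges adjacent is what spoils claws.\<close>

lemma ex_coloring_adjacent_repeat:
  assumes "n \<ge> 3" "n choose 2 = Suc q"
  obtains c where "exact_coloring q (complete_graph n) c" "c {0, 1} = c {0, 2}"
proof -
  let ?E = "edges (complete_graph n)"
  have E: "{0, 1} \<in> ?E" "{0, 2} \<in> ?E"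
    using assms by (auto simp: pair_in_edges_complete_graph)
  have ne: "{0, 2} \<noteq> {0, 1::nat}"
    by (auto simp: doubleton_eq_iff)
  have "card (?E - {{0, 1}}) = card {1..q}"
    using E assms by (simp add: card_edges_complete_graph finite_edges_complete_graph)
  then obtain h where h: "bij_betw h (?E - {{0, 1}}) {1..q}"
    using finite_same_card_bij[of "?E - {{0, 1}}" "{1..q}"] finite_edges_complete_graph by auto
  define c where "c = h({0, 1} := h {0, 2})"
  have "c ` ?E = insert (c {0, 1}) (c ` (?E - {{0, 1}}))"
    using E by auto
  also have "c ` (?E - {{0, 1}}) = {1..q}"
    using h by (auto simp: c_def bij_betw_def)
  also have "insert (c {0, 1}) {1..q} = {1..q}"
    using bij_betwE[OF h] E ne by (subst insert_absorb) (auto simp: c_def simp del: One_nat_def)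
  finally show ?thesis
    using ne by (intro that[of c]) (auto simp: exact_coloring_def c_def)
qed

text \<open>The claws with center 0 and leaves 1, 2, \<open>z\<close> are not rainbow, and there are
  \<open>n - 3\<close> choices of \<open>z\<close>.\<close>

lemma card_nonrainbow_claws_ge:
  assumes "n \<ge> 3" "c {0, 1} = c {0, 2}"
  shows "n - 3 \<le> card (nonrainbow_claws n c)"
proof -
  have "(\<lambda>z. (0, {1, 2, z})) ` {3..<n} \<subseteq> nonrainbow_claws n c"
    using assms by (auto simp: nonrainbow_claws_def claws_def)
  moreover have "inj_on (\<lambda>z. (0::nat, {1, 2, z::nat})) {3..<n}"
    by (auto simp: inj_on_def doubleton_eq_iff insert_eq_iff)
  moreover have "finite (nonrainbow_claws n c)"
    by (rule finite_subset[OF _ finite_claws]) (auto simp: nonrainbow_claws_def)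
  ultimately show ?thesis
    using card_inj_on_le[of "\<lambda>z. (0, {1, 2, z})" "{3..<n}" "nonrainbow_claws n c"] by simp
qed

text \<open>Three edges of one color would form several colliding pairs, but there is only
  one.\<close>

lemma no_monochromatic_copies:
  assumes "exact_coloring q (complete_graph n) c" "n choose 2 = Suc q"
    and "finite_simple_graph H" "card (edges H) \<ge> 3"
  shows "monochromatic_copies c H (complete_graph n) = {}"
proof (rule ccontr)
  assume "monochromatic_copies c H (complete_graph n) \<noteq> {}"
  then obtain F where F: "edges F \<subseteq> edges (complete_graph n)" "isomorphic H F" "monochromatic c F"
    by (auto simp: monochromatic_copies_def copies_def subgraph_def)
  have card: "card (c ` edges (complete_graph n)) = q"
    using assms(1) by (simp add: exact_coloring_def)
  obtain e e' where
    uniq: "\<And>d d'. \<lbrakk>d \<in> edges (complete_graph n); d' \<in> edges (complete_graph n); d \<noteq> d'; c d = c d'\<rbrakk>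
      \<Longrightarrow> {d, d'} = {e, e'}"
    using surj_one_short_repeat[OF finite_edges_complete_graph]
    by (metis card_edges_complete_graph assms(2) card)
  obtain f where f: "bij_betw f (verts H) (verts F)" "edges F = (\<lambda>e. f ` e) ` edges H"
    using F(2) by (auto simp: isomorphic_def)
  \<comment> \<open>Injectivity on vertices passes to edges, so the copy has as many edges as
    \<open>H\<close>.\<close>
  have "inj_on (\<lambda>e. f ` e) (Pow (verts H))"
    using f(1) by (intro inj_on_image_Pow) (simp add: bij_betw_def)
  then have "inj_on (\<lambda>e. f ` e) (edges H)"
    by (rule inj_on_subset) (use assms(3) in \<open>auto simp: finite_simple_graph_def\<close>)
  then have "card (edges F) \<ge> 3"
    using f(2) assms(4) by (simp add: card_image)
  then obtain D where "D \<subseteq> edges F" "card D = 3"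
    using obtain_subset_with_card_n by metis
  then obtain x y z where "x \<in> edges F" "y \<in> edges F" "z \<in> edges F" "x \<noteq> y" "y \<noteq> z" "x \<noteq> z"
    by (auto simp: card_3_iff)
  moreover obtain i where "\<forall>e\<in>edges F. c e = i"
    using F(3) by (auto simp: monochromatic_def)
  ultimately have "{x, y} = {e, e'}" "{y, z} = {e, e'}"
    using F(1) uniq by (metis subsetD)+
  then show False
    using \<open>x \<noteq> y\<close> \<open>y \<noteq> z\<close> \<open>x \<noteq> z\<close> by (auto simp: doubleton_eq_iff)
qed

section \<open>Values of the Gallai-Ramsey number and multiplicity\<close>

lemma gallai_ramsey_eq:
  assumes "t \<ge> 4" "t choose 2 = Suc q" "q \<ge> 4"
    and "copies H (K_parts_of_two (q - 1)) \<noteq> {}"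
  shows "gallai_ramsey q K_1_3 H = t"
  unfolding gallai_ramsey_def
proof (rule Least_equality)
  have "\<exists>c. exact_coloring q (complete_graph t) c"
    using ex_coloring_adjacent_repeat[of t q] assms by auto
  then show "(\<exists>c. exact_coloring q (complete_graph t) c) \<and>
    (\<forall>n\<ge>t. \<forall>c. exact_coloring q (complete_graph n) c \<longrightarrow>
      rainbow_copies c K_1_3 (complete_graph n) \<noteq> {} \<or>
      monochromatic_copies c H (complete_graph n) \<noteq> {})"
    \<comment> \<open>The alternative holds at every order, so the least \<open>N\<close> is decided
      by the existence of an exact coloring.\<close>
    using monochromatic_copy_if_no_rainbow_claw assms by blast
next
  fix N
  assume "(\<exists>c. exact_coloring q (complete_graph N) c) \<and>
    (\<forall>n\<ge>N. \<forall>c. exact_coloring q (complete_graph n) c \<longrightarrow>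
      rainbow_copies c K_1_3 (complete_graph n) \<noteq> {} \<or>
      monochromatic_copies c H (complete_graph n) \<noteq> {})"
  then obtain c where "c ` edges (complete_graph N) = {1..q}"
    by (auto simp: exact_coloring_def)
  then have N: "q \<le> N choose 2"
    using card_image_le[OF finite_edges_complete_graph, of c N]
    by (simp add: card_edges_complete_graph)
  show "t \<le> N"
  proof (rule ccontr)
    assume "\<not> t \<le> N"
    then have "N choose 2 \<le> (t - 1) choose 2"
      by (intro binomial_right_mono) simp
    \<comment> \<open>Removing a vertex loses \<open>t - 1\<close> edges, while \<open>q\<close>
      colors leave only one edge to spare.\<close>
    moreover have "t choose 2 = (t - 1) + ((t - 1) choose 2)"
      using assms(1) by (cases t) (auto simp: numeral_2_eq_2)
    ultimately show False
      using N assms(1,2) by simp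
  qed
qed

text \<open>Without monochromatic copies the total is all claws minus those that are not rainbow, so
  minimizing it means maximizing the latter; their maximum \<open>t - 3\<close> is reached by an
  adjacent repeat.\<close>

lemma gallai_ramsey_multiplicity_eq:
  assumes "t \<ge> 4" "t choose 2 = Suc q" "q \<ge> 4"
    and "finite_simple_graph H" "card (edges H) \<ge> 3"
    and "copies H (K_parts_of_two (q - 1)) \<noteq> {}"
  shows "gallai_ramsey_multiplicity q K_1_3 H = t * ((t - 1) choose 3) - (t - 3)"
proof -
  have count: "card (rainbow_copies c K_1_3 (complete_graph t)) +
      card (monochromatic_copies c H (complete_graph t)) =
      t * ((t - 1) choose 3) - card (nonrainbow_claws t c)"
    if "exact_coloring q (complete_graph t) c" for c
    using no_monochromatic_copies[OF that assms(2,4,5)] card_rainbow_copies_K_1_3[of c t] by simp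
  show ?thesis
    unfolding gallai_ramsey_multiplicity_def gallai_ramsey_eq[OF assms(1-3,6)] Let_def
  proof (rule Least_equality)
    obtain c where c: "exact_coloring q (complete_graph t) c" "c {0, 1} = c {0, 2}"
      using ex_coloring_adjacent_repeat[of t q] assms by auto
    then have "card (nonrainbow_claws t c) = t - 3"
      using card_nonrainbow_claws_le[OF c(1)] card_nonrainbow_claws_ge[of t c] assms
      by (intro antisym) auto
    then show "\<exists>c. exact_coloring q (complete_graph t) c \<and> t * ((t - 1) choose 3) - (t - 3) =
      card (rainbow_copies c K_1_3 (complete_graph t)) +
      card (monochromatic_copies c H (complete_graph t))"
      using c(1) count by metis
  next
    fix m
    assume "\<exists>c. exact_coloring q (complete_graph t) c \<and> m =
      card (rainbow_copies c K_1_3 (complete_graph t)) +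
      card (monochromatic_copies c H (complete_graph t))"
    then obtain c where c: "exact_coloring q (complete_graph t) c"
      and "m = t * ((t - 1) choose 3) - card (nonrainbow_claws t c)"
      using count by metis
    then show "t * ((t - 1) choose 3) - (t - 3) \<le> m"
      using card_nonrainbow_claws_le[OF c assms(2)] by (simp add: diff_le_mono2)
  qed
qed

theorem theorem3p2:
  fixes k t :: nat and H :: "'a ugraph"
  assumes "k = t choose 2" and "k \<ge> 6"
    and "finite_simple_graph H" and "no_isolated_verts H"
    and "card (edges H) \<ge> 3"
    and "copies H (K_parts_of_two (k - 2)) \<noteq> {}"
  shows "gallai_ramsey_multiplicity (k - 1) K_1_3 H =
    (if t = 4 then 3
     else if t = 5 then 18
     else (t - 1) * ((t - 1) choose 3) + ((t - 3) choose 3) + 2 * ((t - 3) choose 2))"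
proof -
  have t: "t \<ge> 4"
  proof (rule ccontr)
    assume "\<not> t \<ge> 4"
    then have "t choose 2 \<le> 3 choose 2"
      by (intro binomial_right_mono) simp
    also have "3 choose 2 = (3::nat)"
      by (simp add: choose_two)
    finally show False
      using assms(1,2) by linarith
  qed
  have GM: "gallai_ramsey_multiplicity (k - 1) K_1_3 H = t * ((t - 1) choose 3) - (t - 3)"
  proof (rule gallai_ramsey_multiplicity_eq[OF t _ _ assms(3,5)])
    show "t choose 2 = Suc (k - 1)" "k - 1 \<ge> 4"
      using assms(1,2) by linarith+
    have "k - 1 - 1 = k - 2"
      by linarith
    then show "copies H (K_parts_of_two (k - 1 - 1)) \<noteq> {}"
      using assms(6) by metis
  qed
  \<comment> \<open>The shift removes truncated subtraction; \<open>X\<close> below is Pascal's rule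
    applied twice.\<close>
  define s where "s = t - 3"
  then have s: "t = s + 3"
    using t by simp
  have X: "(s + 2) choose 3 = (s choose 3) + 2 * (s choose 2) + s"
    by (simp add: numeral_3_eq_3 numeral_2_eq_2)
  \<comment> \<open>One of the \<open>t\<close> binomials is split off to absorb the subtracted
    \<open>s\<close>.\<close>
  have "t * ((t - 1) choose 3) - (t - 3) = (s + 2) * ((s + 2) choose 3) + (((s + 2) choose 3) - s)"
    using X by (simp add: s add_mult_distrib)
  also have "\<dots> = (t - 1) * ((t - 1) choose 3) + ((t - 3) choose 3) + 2 * ((t - 3) choose 2)"
    using X by (simp add: s)
  finally have "t * ((t - 1) choose 3) - (t - 3) =
    (t - 1) * ((t - 1) choose 3) + ((t - 3) choose 3) + 2 * ((t - 3) choose 2)" .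
  moreover have "4 choose 3 = (4::nat)" "3 choose 3 = (1::nat)"
    by (simp_all add: numeral_3_eq_3 eval_nat_numeral)
  \<comment> \<open>The special cases are values of the general formula: 3 * 1 for
    \<open>t = 4\<close> and 4 * 4 + 2 for \<open>t = 5\<close>.\<close>
  ultimately show ?thesis
    unfolding GM by (auto simp: choose_two)
qed

end
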